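(* Assume that the linear operators $\overline{R}:V\to\overline{V}$ and $\overline{P}:\overline{V}\to V$ satisfy $\overline{R}\,\overline{P}=\overline{I}$ and $\overline{R}M^{-1}A=\overline{R}M^{-1}A\,\overline{P}\,\overline{R}$. Given an initial guess $\mathbf{u}^0\in V$ and its substructured restriction $\mathbf{v}^0:=\overline{R}\mathbf{u}^0\in\overline{V}$, define the sequences $\{\mathbf{u}^n\}$ and $\{\mathbf{v}^n\}$ by $$\mathbf{u}^n=G^{\mathrm{RAS}}(\mathbf{u}^{n-1}),\qquad \mathbf{v}^n=G^{\mathrm{SRAS}}(\mathbf{v}^{n-1}),\qquad n\ge 1.$$ Then $\overline{R}\mathbf{u}^n=\mathbf{v}^n$ for every $n\ge 1$.
   Context: Let $V\cong\mathbb{R}^{N_v}$, let $A\in\mathbb{R}^{N_v\times N_v}$ and $\mathbf{f}\in V$ (the linear system to be solved is $A\mathbf{u}=\mathbf{f}$). Let $\mathcal{J}=\{1,\dots,N\}$, and for each $j\in\mathcal{J}$ let $V_j$ be a finite-dimensional real vector space (degrees of freedom of the $j$-th overlapping subdomain) with linear maps $R_j:V\to V_j$ (restriction), $P_j:V_j\to V$ (prolongation) and $\widetilde{P}_j:V_j\to V$ (restricted prolongation) satisfying $$R_jP_j=I_{V_j}\ (j\in\mathcal{J}),\qquad \sum_{j\in\mathcal{J}}\widetilde{P}_jR_j=I,$$ where $I_{V_j}$ and $I$ are the identities on $V_j$ and $V$. Put $A_j:=R_jAP_j$, assumed invertible for each $j$, and define the RAS preconditioner $$M^{-1}:=\sum_{j\in\mathcal{J}}\widetilde{P}_jA_j^{-1}R_j$$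 (here $M^{-1}$ is just the name of this operator). The RAS iteration map $G^{\mathrm{RAS}}:V\to V$ is $$G^{\mathrm{RAS}}(\mathbf{u}):=\sum_{j\in\mathcal{J}}\widetilde{P}_jA_j^{-1}R_j\bigl(\mathbf{f}-A(I-P_jR_j)\mathbf{u}\bigr),$$ equivalently $G^{\mathrm{RAS}}(\mathbf{u})=\mathbf{u}+M^{-1}(\mathbf{f}-A\mathbf{u})$. Let $\overline{V}\cong\mathbb{R}^{\overline{N}}$ (the space of degrees of freedom on the substructure/skeleton), with identity $\overline{I}$, and let $\overline{R}:V\to\overline{V}$, $\overline{P}:\overline{V}\to V$ be linear (restriction to and prolongation from the substructure). The SRAS iteration map $G^{\mathrm{SRAS}}:\overline{V}\to\overline{V}$ is $$G^{\mathrm{SRAS}}(\mathbf{v}):=\overline{R}\,G^{\mathrm{RAS}}(\overline{P}\mathbf{v}).$$ *)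

theory Defs
  imports "HOL-Analysis.Analysis"
begin

text \<open>
  The space of degrees of freedom on the whole domain is \<open>real ^ 'n\<close>. The local spaces
  \<open>W j\<close> have dimensions depending on \<open>j\<close>, so they are finite-dimensional subspaces of one
  arbitrary real vector space \<open>'w\<close> (any family of real vector spaces embeds into its direct sum).
  Maps out of \<open>W j\<close> are only constrained on \<open>W j\<close>.
\<close>

definition findim_subspace :: "'w::real_vector set \<Rightarrow> bool" where
  "findim_subspace W \<longleftrightarrow> subspace W \<and> (\<exists>B. finite B \<and> span B = W)"

definition linear_on :: "'w::real_vector set \<Rightarrow> ('w \<Rightarrow> 'b::real_vector) \<Rightarrow> bool" where
  "linear_on W h \<longleftrightarrow>
     (\<forall>x\<in>W. \<forall>y\<in>W. h (x + y) = h x + h y) \<and> (\<forall>c. \<forall>x\<in>W. h (c *\<^sub>R x) = c *\<^sub>R h x)"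

definition local_op ::
  "real ^ 'n ^ 'n \<Rightarrow> (real ^ 'n \<Rightarrow> 'w) \<Rightarrow> ('w \<Rightarrow> real ^ 'n) \<Rightarrow> 'w \<Rightarrow> 'w::real_vector" where
  "local_op A R P = R \<circ> (*v) A \<circ> P"

text \<open>\<open>ras_prec\<close> is the operator written $M^{-1}$; it is not introduced as the inverse of anything.\<close>

definition ras_prec ::
  "nat \<Rightarrow> real ^ 'n ^ 'n \<Rightarrow> (nat \<Rightarrow> 'w::real_vector set) \<Rightarrow> (nat \<Rightarrow> real ^ 'n \<Rightarrow> 'w) \<Rightarrow>
   (nat \<Rightarrow> 'w \<Rightarrow> real ^ 'n) \<Rightarrow> (nat \<Rightarrow> 'w \<Rightarrow> real ^ 'n) \<Rightarrow> real ^ 'n \<Rightarrow> real ^ 'n" where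
  "ras_prec N A W R P Pt u =
     (\<Sum>j\<in>{1..N}. Pt j (inv_into (W j) (local_op A (R j) (P j)) (R j u)))"

definition ras_map ::
  "nat \<Rightarrow> real ^ 'n ^ 'n \<Rightarrow> (nat \<Rightarrow> 'w::real_vector set) \<Rightarrow> (nat \<Rightarrow> real ^ 'n \<Rightarrow> 'w) \<Rightarrow>
   (nat \<Rightarrow> 'w \<Rightarrow> real ^ 'n) \<Rightarrow> (nat \<Rightarrow> 'w \<Rightarrow> real ^ 'n) \<Rightarrow> real ^ 'n \<Rightarrow> real ^ 'n \<Rightarrow> real ^ 'n" where
  "ras_map N A W R P Pt f u =
     (\<Sum>j\<in>{1..N}. Pt j (inv_into (W j) (local_op A (R j) (P j))
                          (R j (f - A *v (u - P j (R j u))))))"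

definition sras_map ::
  "nat \<Rightarrow> real ^ 'n ^ 'n \<Rightarrow> (nat \<Rightarrow> 'w::real_vector set) \<Rightarrow> (nat \<Rightarrow> real ^ 'n \<Rightarrow> 'w) \<Rightarrow>
   (nat \<Rightarrow> 'w \<Rightarrow> real ^ 'n) \<Rightarrow> (nat \<Rightarrow> 'w \<Rightarrow> real ^ 'n) \<Rightarrow> real ^ 'n \<Rightarrow>
   (real ^ 'n \<Rightarrow> real ^ 'm) \<Rightarrow> (real ^ 'm \<Rightarrow> real ^ 'n) \<Rightarrow> real ^ 'm \<Rightarrow> real ^ 'm" where
  "sras_map N A W R P Pt f Rbar Pbar v = Rbar (ras_map N A W R P Pt f (Pbar v))"

end

theory Submission
  imports Defs
begin

text \<open>
  Since \<open>A\<^sub>j\<^sup>-\<^sup>1 R\<^sub>j A P\<^sub>j R\<^sub>j = R\<^sub>j\<close> and \<open>\<Sum>\<^sub>j Pt\<^sub>j R\<^sub>j = I\<close>, the RAS map is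
  \<open>u + M\<^sup>-\<^sup>1 (f - A u)\<close>. Hence the restriction of its value at \<open>u\<close> involves \<open>u\<close> only through
  \<open>Rbar u\<close> and \<open>Rbar M\<^sup>-\<^sup>1 A u\<close>; by the two assumptions on \<open>Rbar\<close> and \<open>Pbar\<close> both are unchanged
  when \<open>u\<close> is replaced by \<open>Pbar (Rbar u)\<close>.
\<close>

lemma linear_on_add: "linear_on W h \<Longrightarrow> x \<in> W \<Longrightarrow> y \<in> W \<Longrightarrow> h (x + y) = h x + h y"
  and linear_on_scaleR: "linear_on W h \<Longrightarrow> x \<in> W \<Longrightarrow> h (c *\<^sub>R x) = c *\<^sub>R h x"
  by (simp_all add: linear_on_def)

text \<open>Makes each local inverse \<open>A\<^sub>j\<^sup>-\<^sup>1\<close> linear. Every point of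
  \<open>W'\<close> has the form \<open>h x\<close> with \<open>x\<close> in \<open>W\<close>, so
  injectivity of \<open>h\<close> and closure of \<open>W\<close> under the operations reduce both
  identities to those of \<open>h\<close>.\<close>

lemma linear_on_inv_into:
  assumes W: "subspace W" and h: "linear_on W h" and bij: "bij_betw h W W'"
  shows "linear_on W' (inv_into W h)"
proof -
  have inj: "inj_on h W" and im: "h ` W = W'"
    using bij by (auto simp: bij_betw_def)
  have "inv_into W h (h x + h y) = x + y" if "x \<in> W" "y \<in> W" for x y
    by (metis that W h inj inv_into_f_f linear_on_add subspace_add)
  moreover have "inv_into W h (c *\<^sub>R h x) = c *\<^sub>R x" if "x \<in> W" for c x
    by (metis that W h inj inv_into_f_f linear_on_scaleR subspace_scale)
  ultimately show ?thesis
    using inj by (auto simp: linear_on_def simp flip: im)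
qed

lemma linear_on_local_op:
  assumes "linear R" "linear_on W P"
  shows "linear_on W (local_op A R P)"
  using assms
  by (simp add: linear_on_def local_op_def linear_add linear_scale matrix_vector_right_distrib
      matrix_vector_mult_scaleR)

text \<open>Allows \<open>ras_prec\<close> of the residual \<open>f - A *v u\<close> to be split
  into a part from \<open>f\<close> and a part from \<open>u\<close>. Linearity passes through each
  summand because all intermediate values stay in \<open>W j\<close>.\<close>

lemma linear_ras_prec:
  assumes W: "\<And>j. j \<in> {1..N} \<Longrightarrow> subspace (W j)"
    and R: "\<And>j. j \<in> {1..N} \<Longrightarrow> linear (R j)" "\<And>j. j \<in> {1..N} \<Longrightarrow> range (R j) \<subseteq> W j"
    and P: "\<And>j. j \<in> {1..N} \<Longrightarrow> linear_on (W j) (P j)"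
    and Pt: "\<And>j. j \<in> {1..N} \<Longrightarrow> linear_on (W j) (Pt j)"
    and Aj: "\<And>j. j \<in> {1..N} \<Longrightarrow> bij_betw (local_op A (R j) (P j)) (W j) (W j)"
  shows "linear (ras_prec N A W R P Pt)"
proof -
  have "linear (\<lambda>u. Pt j (inv_into (W j) (local_op A (R j) (P j)) (R j u)))"
    if j: "j \<in> {1..N}" for j
  proof -
    let ?B = "inv_into (W j) (local_op A (R j) (P j))"
    have B: "linear_on (W j) ?B"
      using j by (intro linear_on_inv_into linear_on_local_op W R P Aj)
    have RW: "R j x \<in> W j" for x
      using R(2)[OF j] by blast
    \<comment> \<open>\<open>Pt j\<close> is constrained only on \<open>W j\<close>, so its
      arguments must be shown to lie there.\<close>
    have BW: "?B x \<in> W j" if "x \<in> W j" for x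
      using Aj[OF j] that by (metis bij_betw_imp_surj_on inv_into_into)
    show ?thesis
      by (rule linearI)
        (simp_all add: linear_add[OF R(1)[OF j]] linear_scale[OF R(1)[OF j]]
          linear_on_add[OF B] linear_on_scaleR[OF B] linear_on_add[OF Pt[OF j]]
          linear_on_scaleR[OF Pt[OF j]] RW BW)
  qed
  then show ?thesis
    unfolding ras_prec_def[abs_def] by (intro linear_compose_sum) blast
qed

text \<open>Each summand of \<open>ras_map\<close> splits off a term \<open>Pt j (R j u)\<close>,
  and by \<open>PtR\<close> these terms add up to \<open>u\<close>.\<close>

lemma ras_map_eq:
  assumes W: "\<And>j. j \<in> {1..N} \<Longrightarrow> subspace (W j)"
    and R: "\<And>j. j \<in> {1..N} \<Longrightarrow> linear (R j)" "\<And>j. j \<in> {1..N} \<Longrightarrow> range (R j) \<subseteq> W j"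
    and P: "\<And>j. j \<in> {1..N} \<Longrightarrow> linear_on (W j) (P j)"
    and Pt: "\<And>j. j \<in> {1..N} \<Longrightarrow> linear_on (W j) (Pt j)"
    and PtR: "\<And>x. (\<Sum>j\<in>{1..N}. Pt j (R j x)) = x"
    and Aj: "\<And>j. j \<in> {1..N} \<Longrightarrow> bij_betw (local_op A (R j) (P j)) (W j) (W j)"
  shows "ras_map N A W R P Pt f u = u + ras_prec N A W R P Pt (f - A *v u)"
proof -
  have "Pt j (inv_into (W j) (local_op A (R j) (P j)) (R j (f - A *v (u - P j (R j u)))))
      = Pt j (R j u) + Pt j (inv_into (W j) (local_op A (R j) (P j)) (R j (f - A *v u)))"
    if j: "j \<in> {1..N}" for j
  proof -
    let ?L = "local_op A (R j) (P j)"
    let ?B = "inv_into (W j) ?L"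
    have B: "linear_on (W j) ?B"
      using j by (intro linear_on_inv_into linear_on_local_op W R P Aj)
    have RW: "R j x \<in> W j" for x
      using R(2)[OF j] by blast
    have LW: "?L x \<in> W j" if "x \<in> W j" for x
      using Aj[OF j] that by (rule bij_betwE[rule_format])
    have BW: "?B x \<in> W j" if "x \<in> W j" for x
      using Aj[OF j] that by (metis bij_betw_imp_surj_on inv_into_into)
    \<comment> \<open>Regrouped so that applying \<open>R j\<close> turns the first term into the
      local operator at \<open>R j u\<close>, which \<open>?B\<close> then cancels.\<close>
    have "f - A *v (u - P j (R j u)) = A *v P j (R j u) + (f - A *v u)"
      by (simp add: matrix_vector_mult_diff_distrib)
    then have "R j (f - A *v (u - P j (R j u))) = ?L (R j u) + R j (f - A *v u)"
      by (simp only: linear_add[OF R(1)[OF j]] local_op_def o_apply)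
    moreover have "?B (?L (R j u)) = R j u"
      using Aj[OF j] RW by (meson bij_betw_inv_into_left)
    ultimately have "?B (R j (f - A *v (u - P j (R j u)))) = R j u + ?B (R j (f - A *v u))"
      by (simp add: linear_on_add[OF B] RW LW)
    then show ?thesis
      by (simp add: linear_on_add[OF Pt[OF j]] RW BW)
  qed
  \<comment> \<open>Keeping \<open>1\<close> from becoming \<open>Suc 0\<close> lets the sum over
    \<open>{1..N}\<close> match \<open>PtR\<close>.\<close>
  then show ?thesis
    by (simp add: ras_map_def ras_prec_def sum.distrib PtR del: One_nat_def)
qed

theorem theorem3p1:
  fixes N :: nat
    and A :: "real ^ 'n ^ 'n"
    and f :: "real ^ 'n"
    and W :: "nat \<Rightarrow> 'w::real_vector set"
    and R :: "nat \<Rightarrow> real ^ 'n \<Rightarrow> 'w"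
    and P Pt :: "nat \<Rightarrow> 'w \<Rightarrow> real ^ 'n"
    and Rbar :: "real ^ 'n \<Rightarrow> real ^ 'm"
    and Pbar :: "real ^ 'm \<Rightarrow> real ^ 'n"
    and u :: "nat \<Rightarrow> real ^ 'n"
    and v :: "nat \<Rightarrow> real ^ 'm"
  assumes W: "\<And>j. j \<in> {1..N} \<Longrightarrow> findim_subspace (W j)"
    and R: "\<And>j. j \<in> {1..N} \<Longrightarrow> linear (R j) \<and> range (R j) \<subseteq> W j"
    and P: "\<And>j. j \<in> {1..N} \<Longrightarrow> linear_on (W j) (P j)"
    and Pt: "\<And>j. j \<in> {1..N} \<Longrightarrow> linear_on (W j) (Pt j)"
    and RP: "\<And>j x. j \<in> {1..N} \<Longrightarrow> x \<in> W j \<Longrightarrow> R j (P j x) = x"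
    and PtR: "\<And>x. (\<Sum>j\<in>{1..N}. Pt j (R j x)) = x"
    and Aj: "\<And>j. j \<in> {1..N} \<Longrightarrow> bij_betw (local_op A (R j) (P j)) (W j) (W j)"
    and Rbar: "linear Rbar"
    and Pbar: "linear Pbar"
    and RPbar: "Rbar \<circ> Pbar = id"
    and comm: "Rbar \<circ> ras_prec N A W R P Pt \<circ> (*v) A =
               Rbar \<circ> ras_prec N A W R P Pt \<circ> (*v) A \<circ> Pbar \<circ> Rbar"
    and v0: "v 0 = Rbar (u 0)"
    and u_step: "\<And>n. n \<ge> 1 \<Longrightarrow> u n = ras_map N A W R P Pt f (u (n - 1))"
    and v_step: "\<And>n. n \<ge> 1 \<Longrightarrow> v n = sras_map N A W R P Pt f Rbar Pbar (v (n - 1))"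
  shows "\<forall>n\<ge>1. Rbar (u n) = v n"
proof -
  let ?M = "ras_prec N A W R P Pt" and ?G = "ras_map N A W R P Pt f"
  have sub: "subspace (W j)" if "j \<in> {1..N}" for j
    using W[OF that] by (simp add: findim_subspace_def)
  have M: "linear ?M"
    using R by (intro linear_ras_prec sub P Pt Aj) auto
  have G: "?G x = x + ?M (f - A *v x)" for x
    using R by (intro ras_map_eq sub P Pt PtR Aj) auto
  have RG: "Rbar (?G x) = Rbar x + Rbar (?M f) - Rbar (?M (A *v x))" for x
    by (simp add: G linear_add[OF Rbar] linear_diff[OF Rbar] linear_diff[OF M])
  have RP': "Rbar (Pbar y) = y" for y
    using fun_cong[OF RPbar, of y] by simp
  have comm': "Rbar (?M (A *v Pbar (Rbar x))) = Rbar (?M (A *v x))" for x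
    using fun_cong[OF comm, of x] by simp
  \<comment> \<open>\<open>RG\<close> is used at both \<open>Pbar (Rbar x)\<close> and
    \<open>x\<close>: \<open>RP'\<close> matches the first terms, \<open>comm'\<close> the last, and
    the term from \<open>f\<close> is common. No relation between \<open>x\<close> and the range of
    \<open>Pbar\<close> is involved.\<close>
  have step: "sras_map N A W R P Pt f Rbar Pbar (Rbar x) = Rbar (?G x)" for x
    by (simp add: sras_map_def RG RP' comm')
  \<comment> \<open>Proved from \<open>n = 0\<close> on, so that \<open>v0\<close> serves as the
    base case.\<close>
  have "Rbar (u n) = v n" for n
  proof (induction n)
    case 0
    show ?case by (simp add: v0)
  next
    case (Suc n)
    then show ?case
      using u_step[of "Suc n"] v_step[of "Suc n"] step[of "u n"] by simp
  qed
  then show ?thesis by blast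
qed

end
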